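(* Suppose that $f\in\mathcal{B}$ and $f(z)=\sum_{n=0}^{\infty}a_nz^n$. Then $$|f(z)|+|f'(z)|r+\sum_{n=2}^{\infty}|a_n|r^n+\left(\frac{1}{1+|a_0|}+\frac{r}{1-r}\right)\sum_{n=1}^{\infty}|a_n|^2r^{2n}\le 1\quad\text{for } |z|=r\le\frac{\sqrt{17}-3}{4},$$ and the constant $\frac{\sqrt{17}-3}{4}$ is best possible. Moreover, $$|f(z)|^2+|f'(z)|r+\sum_{n=2}^{\infty}|a_n|r^n+\left(\frac{1}{1+|a_0|}+\frac{r}{1-r}\right)\sum_{n=1}^{\infty}|a_n|^2r^{2n}\le 1\quad\text{for } |z|=r\le r_0,$$ where $r_0\approx0.385795$ is the unique positive root of the equation $1-2r-r^2-r^3-r^4=0$, and $r_0$ is best possible.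
   Context: $\mathbb{D}=\{z\in\mathbb{C}:|z|<1\}$ and $\mathcal{B}$ is the set of all analytic functions $f:\mathbb{D}\to\mathbb{D}$. "Best possible" means that the radius cannot be replaced by any larger number so that the corresponding inequality still holds for all $f\in\mathcal{B}$. *)

theory Defs
  imports "HOL-Complex_Analysis.Complex_Analysis"
begin

definition unit_disc_self_maps :: "(complex \<Rightarrow> complex) set" where
  "unit_disc_self_maps = {f. f analytic_on ball 0 1 \<and> f ` ball 0 1 \<subseteq> ball 0 1}"

definition has_disc_expansion :: "(complex \<Rightarrow> complex) \<Rightarrow> (nat \<Rightarrow> complex) \<Rightarrow> bool" where
  "has_disc_expansion f a \<longleftrightarrow> (\<forall>z\<in>ball 0 1. (\<lambda>n. a n * z ^ n) sums f z)"

(* The exponent p is 1 or 2.  The sums over n >= 2 and n >= 1 are written with shifted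
   index; both converge absolutely for norm z < 1, where the functional is used. *)
definition bohr_functional ::
    "nat \<Rightarrow> (complex \<Rightarrow> complex) \<Rightarrow> (nat \<Rightarrow> complex) \<Rightarrow> complex \<Rightarrow> real" where
  "bohr_functional p f a z =
     (let r = norm z in
        norm (f z) ^ p + norm (deriv f z) * r
        + (\<Sum>n. norm (a (n + 2)) * r ^ (n + 2))
        + (1 / (1 + norm (a 0)) + r / (1 - r))
          * (\<Sum>n. (norm (a (n + 1)))\<^sup>2 * r ^ (2 * (n + 1))))"

(* The condition z : ball 0 1 only matters for R >= 1, where f z would be meaningless. *)
definition bohr_inequality_upto :: "nat \<Rightarrow> real \<Rightarrow> bool" where
  "bohr_inequality_upto p R \<longleftrightarrow>
     (\<forall>f\<in>unit_disc_self_maps. \<forall>a. has_disc_expansion f a \<longrightarrow>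
        (\<forall>z\<in>ball 0 1. norm z \<le> R \<longrightarrow> bohr_functional p f a z \<le> 1))"

end

theory Submission
  imports Defs
begin

text \<open>
  Multiplication by \<open>f\<close> is a contraction on \<open>H\<^sup>2\<close>, so the lower triangular Toeplitz matrices of the
  coefficients \<open>a\<^sub>n\<close> are contractions. Testing them on suitable vectors yields Carlson's inequalities
  \<open>|a\<^sub>2\<^sub>n\<^sub>+\<^sub>1| \<le> 1 - \<Sum>\<^sub>k\<^sub>\<le>\<^sub>n |a\<^sub>k|\<^sup>2\<close> and
  \<open>|a\<^sub>2\<^sub>n| \<le> 1 - \<Sum>\<^sub>k\<^sub><\<^sub>n |a\<^sub>k|\<^sup>2 - |a\<^sub>n|\<^sup>2 / (1 + |a\<^sub>0|)\<close>. Summed against \<open>r\<^sup>n\<close> they bound all terms of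
  the functional except the first two by \<open>(1 - |a\<^sub>0|\<^sup>2) r\<^sup>2 / (1 - r)\<close>, and the first two are controlled by the
  Schwarz-Pick lemma. All these bounds are equalities for \<open>f z = (a - z) / (1 - a z)\<close> at \<open>z = - r\<close>, so the
  question becomes when an explicit function of \<open>a\<close> and \<open>r\<close> is at most 1; the critical case is \<open>a \<longrightarrow> 1\<close>.
\<close>

subsection \<open>Toeplitz contractions\<close>

lemma sum_roots_of_unity_orthogonal:
  assumes "k < L" "l < L"
  shows "(\<Sum>j<L. cis (2 * pi * real j / L) ^ k * cnj (cis (2 * pi * real j / L)) ^ l) =
         (if k = l then of_nat L else (0::complex))"
proof -
  \<comment> \<open>The summand is \<open>v ^ j\<close>, so the sum is geometric and
    \<open>v ^ L = 1\<close>. It vanishes unless \<open>v = 1\<close>, which for distinct indices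
    would make k - l a nonzero multiple of L.\<close>
  define v where "v = cis (2 * pi * (real k - real l) / L)"
  have L: "L > 0" using assms by simp
  have eq: "cis (2 * pi * real j / L) ^ k * cnj (cis (2 * pi * real j / L)) ^ l = v ^ j" for j
    unfolding v_def Complex.DeMoivre cis_cnj cis_mult
    by (rule arg_cong[where f = cis]) (simp add: algebra_simps diff_divide_distrib)
  show ?thesis
  proof (cases "k = l")
    case True
    then show ?thesis unfolding eq by (simp add: v_def)
  next
    case False
    have "v \<noteq> 1"
    proof
      assume "v = 1"
      then have "cos (2 * pi * (real k - real l) / L) = 1"
        by (simp add: v_def complex_eq_iff)
      then obtain n :: int where "2 * pi * (real k - real l) / L = of_int n * 2 * pi"
        by (auto simp: cos_one_2pi_int)
      then have "2 * pi * (real k - real l) = 2 * pi * (real_of_int n * real L)"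
        using L by (simp add: field_simps)
      then have "real k - real l = real_of_int n * real L" by simp
      then have "real_of_int (int k - int l) = real_of_int (n * int L)" by simp
      then have e: "int k - int l = n * int L" by (simp only: of_int_eq_iff)
      have "n \<noteq> 0" using e False by auto
      then have "int L * 1 \<le> int L * \<bar>n\<bar>" by (intro mult_left_mono) auto
      moreover have "\<bar>int k - int l\<bar> < int L" using assms by linarith
      ultimately show False using e by (simp add: abs_mult mult.commute)
    qed
    moreover have "v ^ L = 1"
    proof -
      have "v ^ L = cis (2 * pi * (real k - real l))"
        using L by (simp add: v_def Complex.DeMoivre)
      also have "\<dots> = cis (2 * pi * k) * cnj (cis (2 * pi * l))"
        by (simp add: cis_cnj cis_mult algebra_simps)
      also have "\<dots> = 1"
        by (metis Ints_of_nat cis_multiple_2pi complex_cnj_one mult.right_neutral)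
      finally show ?thesis .
    qed
    ultimately show ?thesis
      unfolding eq using False by (simp add: geometric_sum)
  qed
qed

lemma poly_eq_sum_lessThan:
  fixes q :: "'a::comm_semiring_1 poly"
  assumes "degree q < L"
  shows "poly q z = (\<Sum>k<L. coeff q k * z ^ k)"
  unfolding poly_altdef using assms
  by (intro sum.mono_neutral_left) (auto simp: coeff_eq_0)

text \<open>Parseval's identity with the mean over the circle replaced by a mean over L nodes; this
  is exact because the degree is below L.\<close>

lemma sum_roots_of_unity_norm_poly:
  assumes "degree q < L"
  shows "(\<Sum>j<L. (norm (poly q (cis (2 * pi * real j / L))))\<^sup>2) = L * (\<Sum>k<L. (norm (coeff q k))\<^sup>2)"
proof -
  let ?w = "\<lambda>j. cis (2 * pi * real j / real L)"
  have "complex_of_real (\<Sum>j<L. (norm (poly q (?w j)))\<^sup>2) =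
        (\<Sum>j<L. \<Sum>k<L. \<Sum>l<L. (coeff q k * cnj (coeff q l)) * (?w j ^ k * cnj (?w j) ^ l))"
    by (simp add: complex_norm_square poly_eq_sum_lessThan[OF assms] sum_product mult_ac
             del: of_real_power flip: of_real_power)
  also have "\<dots> = (\<Sum>k<L. \<Sum>l<L. \<Sum>j<L. (coeff q k * cnj (coeff q l)) * (?w j ^ k * cnj (?w j) ^ l))"
    by (subst sum.swap, rule sum.cong[OF refl], rule sum.swap)
  also have "\<dots> = (\<Sum>k<L. \<Sum>l<L. (coeff q k * cnj (coeff q l)) * (if k = l then of_nat L else 0))"
    by (intro sum.cong refl) (simp only: sum_distrib_left[symmetric] sum_roots_of_unity_orthogonal lessThan_iff)
  also have "\<dots> = (\<Sum>k<L. coeff q k * cnj (coeff q k) * of_nat L)"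
    by (simp add: if_distrib[of "\<lambda>x. _ * x"] cong: if_cong)
  also have "\<dots> = complex_of_real (L * (\<Sum>k<L. (norm (coeff q k))\<^sup>2))"
    by (simp add: complex_norm_square sum_distrib_left mult_ac del: of_real_power flip: of_real_power)
  finally show ?thesis by (simp only: of_real_eq_iff)
qed

text \<open>Multiplication by F has norm at most C on H2: at the roots of unity the bound on F can
  be used pointwise, and Parseval on both sides turns values into coefficients.\<close>

lemma sum_norm_coeff_mult_le:
  fixes F P :: "complex poly"
  assumes F: "\<And>z. norm z = 1 \<Longrightarrow> norm (poly F z) \<le> C" and P: "degree P \<le> K"
  shows "(\<Sum>m\<le>M. (norm (coeff (F * P) m))\<^sup>2) \<le> C\<^sup>2 * (\<Sum>k\<le>K. (norm (coeff P k))\<^sup>2)"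
proof -
  \<comment> \<open>Enough nodes for Parseval to be exact for both \<open>F * P\<close> and P, and
    for the index ranges up to M and K to fit below L.\<close>
  define L where "L = M + degree (F * P) + K + 1"
  let ?w = "\<lambda>j. cis (2 * pi * real j / real L)"
  have L: "degree (F * P) < L" "degree P < L" "M < L" "K < L" "L > 0"
    using P by (auto simp: L_def)
  have "L * (\<Sum>m\<le>M. (norm (coeff (F * P) m))\<^sup>2) \<le> L * (\<Sum>m<L. (norm (coeff (F * P) m))\<^sup>2)"
    using L by (intro mult_left_mono sum_mono2) auto
  also have "\<dots> = (\<Sum>j<L. (norm (poly F (?w j)))\<^sup>2 * (norm (poly P (?w j)))\<^sup>2)"
    by (simp add: sum_roots_of_unity_norm_poly[OF L(1), symmetric] norm_mult power_mult_distrib)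
  also have "\<dots> \<le> (\<Sum>j<L. C\<^sup>2 * (norm (poly P (?w j)))\<^sup>2)"
    by (intro sum_mono mult_right_mono power_mono F) auto
  also have "\<dots> = L * (C\<^sup>2 * (\<Sum>k<L. (norm (coeff P k))\<^sup>2))"
    by (simp add: sum_distrib_left[symmetric] sum_roots_of_unity_norm_poly[OF L(2)])
  also have "(\<Sum>k<L. (norm (coeff P k))\<^sup>2) = (\<Sum>k\<le>K. (norm (coeff P k))\<^sup>2)"
    using L P by (intro sum.mono_neutral_right) (auto simp: coeff_eq_0)
  finally show ?thesis using L(5) by simp
qed

section \<open>Power series in the disc and their Toeplitz matrices\<close>

lemma disc_expansion_abs_summable:
  assumes "has_disc_expansion f a" "0 \<le> \<rho>" "\<rho> < 1"
  shows "summable (\<lambda>n. norm (a n) * \<rho> ^ n)"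
proof -
  \<comment> \<open>Convergence at (1 + \<rho>) / 2, strictly between \<rho> and 1, gives absolute
    convergence at \<rho>.\<close>
  have "summable (\<lambda>n. a n * of_real ((1 + \<rho>) / 2) ^ n)"
    using assms by (intro sums_summable[where l = "f (of_real ((1 + \<rho>) / 2))"])
      (auto simp: has_disc_expansion_def simp del: of_real_add of_real_divide)
  then have "summable (\<lambda>n. norm (a n * of_real \<rho> ^ n))"
    by (rule powser_insidea) (use assms in \<open>auto simp del: of_real_add of_real_divide\<close>)
  then show ?thesis using assms by (simp add: norm_mult norm_power)
qed

lemma disc_expansion_coeff_0:
  assumes "has_disc_expansion f a"
  shows "a 0 = f 0"
proof -
  have "(\<lambda>n. a n * 0 ^ n) sums f 0"
    using assms unfolding has_disc_expansion_def by (rule bspec) simp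
  then show ?thesis
    unfolding powser_sums_zero_iff .
qed

text \<open>The matrix acts on the truncations of \<open>f (\<rho> z)\<close>, which are uniformly close to the unit ball
  on the circle; then the truncation is removed and \<open>\<rho>\<close> tends to 1.\<close>

lemma toeplitz_contraction:
  assumes f: "\<And>z. z \<in> ball 0 1 \<Longrightarrow> norm (f z) \<le> 1" and a: "has_disc_expansion f a"
  shows "(\<Sum>m\<le>M. (norm (\<Sum>i\<le>m. a i * p (m - i)))\<^sup>2) \<le> (\<Sum>k\<le>M. (norm (p k))\<^sup>2)"
proof -
  define S where "S = (\<Sum>k\<le>M. (norm (p k))\<^sup>2)"
  define T where "T = (\<lambda>\<rho>::real. \<Sum>m\<le>M. (norm (\<Sum>i\<le>m. a i * of_real \<rho> ^ i * p (m - i)))\<^sup>2)"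
  define P where "P = (\<Sum>k\<le>M. monom (p k) k)"
  have coeffP: "coeff P k = (if k \<le> M then p k else 0)" for k
    by (auto simp: P_def coeff_sum)
  have degP: "degree P \<le> M"
    by (rule degree_le) (auto simp: coeffP)
  have bound: "T \<rho> \<le> (1 + \<epsilon>)\<^sup>2 * S" if \<rho>: "0 \<le> \<rho>" "\<rho> < 1" and \<epsilon>: "\<epsilon> > 0" for \<rho> \<epsilon>
  proof -
    have summ: "summable (\<lambda>n. norm (a n) * \<rho> ^ n)"
      by (rule disc_expansion_abs_summable[OF a \<rho>])
    obtain N0 where N0: "\<And>n. n \<ge> N0 \<Longrightarrow> norm (\<Sum>i. norm (a (i + n)) * \<rho> ^ (i + n)) < \<epsilon>"
      using suminf_exist_split[OF \<epsilon> summ] by blast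
    \<comment> \<open>\<open>N \<ge> N0\<close> makes the tail smaller than \<epsilon>;
      \<open>N > M\<close> ensures that truncation leaves the coefficients of the product up to M
      unchanged.\<close>
    define N where "N = N0 + M + 1"
    define F where "F = (\<Sum>i<N. monom (a i * of_real \<rho> ^ i) i)"
    have coeffF: "coeff F i = (if i < N then a i * of_real \<rho> ^ i else 0)" for i
      by (auto simp: F_def coeff_sum)
    have "norm (poly F z) \<le> 1 + \<epsilon>" if z: "norm z = 1" for z
    proof -
      let ?u = "of_real \<rho> * z"
      have u: "?u \<in> ball 0 1" using \<rho> z by (simp add: norm_mult)
      have s: "(\<lambda>i. a i * ?u ^ i) sums f ?u"
        using a u by (auto simp: has_disc_expansion_def)
      have nu: "norm (a i * ?u ^ i) = norm (a i) * \<rho> ^ i" for i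
        using \<rho> z by (simp add: norm_mult norm_power)
      have "poly F z = (\<Sum>i<N. a i * ?u ^ i)"
        by (simp add: F_def poly_sum poly_monom power_mult_distrib mult_ac)
      also have "\<dots> = f ?u - (\<Sum>i. a (i + N) * ?u ^ (i + N))"
        using suminf_split_initial_segment[OF sums_summable[OF s], of N] sums_unique[OF s]
        by simp
      finally have "norm (poly F z) \<le> norm (f ?u) + norm (\<Sum>i. a (i + N) * ?u ^ (i + N))"
        by (simp add: norm_triangle_ineq4)
      also have "norm (\<Sum>i. a (i + N) * ?u ^ (i + N)) \<le> (\<Sum>i. norm (a (i + N) * ?u ^ (i + N)))"
        by (rule summable_norm) (use summable_ignore_initial_segment[OF summ, of N] nu in simp)
      also have "\<dots> = (\<Sum>i. norm (a (i + N)) * \<rho> ^ (i + N))"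
        by (simp only: nu)
      also have "\<dots> \<le> \<epsilon>" using N0[of N] by (simp add: N_def)
      finally show ?thesis using f[OF u] by simp
    qed
    from sum_norm_coeff_mult_le[of F, OF this degP, of M]
    have "(\<Sum>m\<le>M. (norm (coeff (F * P) m))\<^sup>2) \<le> (1 + \<epsilon>)\<^sup>2 * S"
      by (simp add: coeffP S_def)
    also have "(\<Sum>m\<le>M. (norm (coeff (F * P) m))\<^sup>2) = T \<rho>"
      unfolding T_def coeff_mult
      by (intro sum.cong refl arg_cong[where f = "\<lambda>x. (norm x)\<^sup>2"]) (auto simp: coeffF coeffP N_def)
    finally show ?thesis .
  qed
  have bound': "T \<rho> \<le> S" if \<rho>: "0 \<le> \<rho>" "\<rho> < 1" for \<rho>
  proof (rule tendsto_lowerbound)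
    show "((\<lambda>\<epsilon>. (1 + \<epsilon>)\<^sup>2 * S) \<longlongrightarrow> S) (at_right 0)"
      by (auto intro!: tendsto_eq_intros)
    show "eventually (\<lambda>\<epsilon>. T \<rho> \<le> (1 + \<epsilon>)\<^sup>2 * S) (at_right 0)"
      using bound[OF \<rho>] by (auto simp: eventually_at_filter)
  qed auto
  have "T 1 \<le> S"
  proof (rule tendsto_upperbound)
    show "(T \<longlongrightarrow> T 1) (at_left 1)"
      unfolding T_def by (auto intro!: tendsto_eq_intros)
    show "eventually (\<lambda>\<rho>. T \<rho> \<le> S) (at_left 1)"
      using eventually_at_left[of 0 "1::real"] bound' by (auto intro: exI[of _ 0])
  qed auto
  then show ?thesis by (simp add: T_def S_def)
qed

subsection \<open>Carlson's coefficient inequalities and the refined Bohr inequality\<close>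

lemma norm_eq_unimodular_mult:
  fixes c :: complex
  obtains u where "norm u = 1" "c = of_real (norm c) * u"
proof (cases "c = 0")
  case True
  then show ?thesis using that[of 1] by simp
next
  case False
  then show ?thesis using that[of "sgn c"] by (simp add: sgn_div_norm norm_divide scaleR_conv_of_real field_simps)
qed

text \<open>The test vector is 1 followed, in its upper half, by the conjugated coefficients in
  reverse order, rotated by the phase u. The upper half does not reach the outputs up to n, which
  stay \<open>a m\<close>, while in the top output all terms share the phase u and add up to
  \<open>norm (a (2 * n + 1)) + \<sigma>\<close>. Contraction then reads \<sigma> + (top)^2 \<le> 1
  + \<sigma>.\<close>

lemma norm_coeff_odd_le:
  assumes f: "\<And>z. z \<in> ball 0 1 \<Longrightarrow> norm (f z) \<le> 1" and a: "has_disc_expansion f a"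
  shows "norm (a (2 * n + 1)) \<le> 1 - (\<Sum>k\<le>n. (norm (a k))\<^sup>2)"
proof -
  define \<sigma> where "\<sigma> = (\<Sum>k\<le>n. (norm (a k))\<^sup>2)"
  obtain u where u: "norm u = 1" "a (2 * n + 1) = of_real (norm (a (2 * n + 1))) * u"
    by (rule norm_eq_unimodular_mult)
  define p where "p = (\<lambda>k. if k = 0 then 1 else if n < k then u * cnj (a (2 * n + 1 - k)) else 0)"
  define c where "c = (\<lambda>m. \<Sum>i\<le>m. a i * p (m - i))"
  have c_low: "c m = a m" if "m \<le> n" for m
  proof -
    have "c m = (\<Sum>i\<in>{m}. a i * p (m - i))"
      unfolding c_def using that by (intro sum.mono_neutral_right) (auto simp: p_def)
    then show ?thesis by (simp add: p_def)
  qed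
  have "c (2 * n + 1) = (\<Sum>i\<in>insert (2 * n + 1) {..n}. a i * p (2 * n + 1 - i))"
    unfolding c_def by (intro sum.mono_neutral_right) (auto simp: p_def)
  also have "\<dots> = a (2 * n + 1) + (\<Sum>i\<le>n. a i * p (2 * n + 1 - i))"
    by (subst sum.insert) (auto simp: p_def)
  also have "(\<Sum>i\<le>n. a i * p (2 * n + 1 - i)) = (\<Sum>i\<le>n. u * of_real ((norm (a i))\<^sup>2))"
    by (intro sum.cong refl) (auto simp: p_def complex_norm_square mult_ac simp del: of_real_power)
  also have "a (2 * n + 1) + \<dots> = u * of_real (norm (a (2 * n + 1)) + \<sigma>)"
    by (subst u(2)) (simp add: \<sigma>_def sum_distrib_left ring_distribs mult_ac)
  finally have c_top: "norm (c (2 * n + 1)) = norm (a (2 * n + 1)) + \<sigma>"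
    using u(1) by (simp add: norm_mult \<sigma>_def sum_nonneg del: of_real_add)
  have "\<sigma> + (norm (a (2 * n + 1)) + \<sigma>)\<^sup>2 = (\<Sum>m\<in>insert (2 * n + 1) {..n}. (norm (c m))\<^sup>2)"
    by (subst sum.insert) (auto simp: c_top[simplified] c_low \<sigma>_def)
  also have "\<dots> \<le> (\<Sum>m\<le>2 * n + 1. (norm (c m))\<^sup>2)"
    by (intro sum_mono2) auto
  also have "\<dots> \<le> (\<Sum>k\<le>2 * n + 1. (norm (p k))\<^sup>2)"
    unfolding c_def by (rule toeplitz_contraction[OF f a])
  also have "\<dots> = (\<Sum>k\<in>insert 0 {n<..2 * n + 1}. (norm (p k))\<^sup>2)"
    by (intro sum.mono_neutral_right) (auto simp: p_def)
  also have "\<dots> = 1 + (\<Sum>k\<in>{n<..2 * n + 1}. (norm (p k))\<^sup>2)"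
    by (subst sum.insert) (auto simp: p_def)
  \<comment> \<open>The reflection k \<mapsto> 2n + 1 - k carries the upper half of the indices onto
    0, ..., n.\<close>
  also have "(\<Sum>k\<in>{n<..2 * n + 1}. (norm (p k))\<^sup>2) = \<sigma>"
    unfolding \<sigma>_def using u(1)
    by (intro sum.reindex_bij_witness[of _ "\<lambda>k. 2 * n + 1 - k" "\<lambda>k. 2 * n + 1 - k"])
       (auto simp: p_def norm_mult)
  finally have "norm (a (2 * n + 1)) + \<sigma> \<le> 1"
    by (simp add: power_le_one_iff abs_square_le_1)
  then show ?thesis by (simp add: \<sigma>_def)
qed

text \<open>The reflected test vector works again, except that n is now its own mirror image: the
  entry placed there also enters the output \<open>c n\<close>, multiplied by \<open>a 0\<close>.
  This feedback costs the factor 1 + |a_0| in the last term.\<close>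

lemma norm_coeff_even_le:
  assumes f: "\<And>z. z \<in> ball 0 1 \<Longrightarrow> norm (f z) \<le> 1" and a: "has_disc_expansion f a" and n: "n > 0"
  shows "norm (a (2 * n)) \<le> 1 - (\<Sum>k<n. (norm (a k))\<^sup>2) - (norm (a n))\<^sup>2 / (1 + norm (a 0))"
proof -
  define \<sigma> where "\<sigma> = (\<Sum>k<n. (norm (a k))\<^sup>2)"
  \<comment> \<open>The weight \<open>\<mu>\<close> of the \<open>n\<close>-th test coefficient solves \<open>1 - |a\<^sub>0| \<mu> = \<mu>\<close>, so that
    the term \<open>\<mu>\<^sup>2 |a\<^sub>n|\<^sup>2\<close> occurs on both sides and cancels.\<close>
  define \<mu> where "\<mu> = 1 / (1 + norm (a 0))"
  have pos: "1 + norm (a 0) > 0" using norm_ge_zero[of "a 0"] by linarith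
  then have \<mu>: "\<mu> > 0" "1 - norm (a 0) * \<mu> = \<mu>"
    unfolding \<mu>_def by (auto simp: field_simps)
  obtain u where u: "norm u = 1" "a (2 * n) = of_real (norm (a (2 * n))) * u"
    by (rule norm_eq_unimodular_mult)
  define p where "p = (\<lambda>k. if k = 0 then 1 else if k = n then u * of_real \<mu> * cnj (a n)
     else if n < k then u * cnj (a (2 * n - k)) else 0)"
  define c where "c = (\<lambda>m. \<Sum>i\<le>m. a i * p (m - i))"
  have c_low: "c m = a m" if "m < n" for m
  proof -
    have "c m = (\<Sum>i\<in>{m}. a i * p (m - i))"
      unfolding c_def using that by (intro sum.mono_neutral_right) (auto simp: p_def)
    then show ?thesis by (simp add: p_def)
  qed
  have "c n = (\<Sum>i\<in>{0, n}. a i * p (n - i))"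
    unfolding c_def by (intro sum.mono_neutral_right) (auto simp: p_def)
  then have "c n = a n + a 0 * (u * of_real \<mu> * cnj (a n))"
    using n by (simp add: p_def)
  \<comment> \<open>In the worst case the feedback through \<open>a 0\<close> is opposed to
    \<open>a n\<close>; what survives is still \<mu> times \<open>norm (a n)\<close>.\<close>
  then have "norm (a n) - norm (a 0) * \<mu> * norm (a n) \<le> norm (c n)"
    using norm_diff_ineq[of "a n" "a 0 * (u * of_real \<mu> * cnj (a n))"] u(1) \<mu>(1)
    by (simp add: norm_mult mult_ac)
  then have "\<mu> * norm (a n) \<le> norm (c n)"
    using arg_cong[OF \<mu>(2), of "\<lambda>x. x * norm (a n)"]
    by (simp only: left_diff_distrib mult_1)
  then have c_mid: "\<mu>\<^sup>2 * (norm (a n))\<^sup>2 \<le> (norm (c n))\<^sup>2"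
    using \<mu>(1) power_mono[of "\<mu> * norm (a n)" "norm (c n)" 2] by (simp add: power_mult_distrib)
  have "c (2 * n) = (\<Sum>i\<in>insert (2 * n) (insert n {..<n}). a i * p (2 * n - i))"
    unfolding c_def by (intro sum.mono_neutral_right) (auto simp: p_def)
  also have "\<dots> = a (2 * n) + (a n * p n + (\<Sum>i<n. a i * p (2 * n - i)))"
    using n by (subst sum.insert) (auto simp: p_def mult_2)
  also have "(\<Sum>i<n. a i * p (2 * n - i)) = (\<Sum>i<n. u * of_real ((norm (a i))\<^sup>2))"
    by (intro sum.cong refl) (auto simp: p_def complex_norm_square mult_ac simp del: of_real_power)
  also have "a n * p n = u * of_real (\<mu> * (norm (a n))\<^sup>2)"
    using n by (simp add: p_def complex_norm_square mult_ac del: of_real_power)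
  also have "a (2 * n) + (u * of_real (\<mu> * (norm (a n))\<^sup>2) + (\<Sum>i<n. u * of_real ((norm (a i))\<^sup>2))) =
      u * of_real (norm (a (2 * n)) + \<mu> * (norm (a n))\<^sup>2 + \<sigma>)"
    by (subst u(2)) (simp add: \<sigma>_def sum_distrib_left ring_distribs mult_ac)
  finally have "c (2 * n) = u * of_real (norm (a (2 * n)) + \<mu> * (norm (a n))\<^sup>2 + \<sigma>)" .
  then have c_top: "norm (c (2 * n)) = norm (a (2 * n)) + \<mu> * (norm (a n))\<^sup>2 + \<sigma>"
    using u(1) \<mu>(1) by (simp add: norm_mult \<sigma>_def sum_nonneg del: of_real_add of_real_mult)
  have "\<sigma> + \<mu>\<^sup>2 * (norm (a n))\<^sup>2 + (norm (a (2 * n)) + \<mu> * (norm (a n))\<^sup>2 + \<sigma>)\<^sup>2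
      \<le> (\<Sum>m\<in>insert (2 * n) (insert n {..<n}). (norm (c m))\<^sup>2)"
    using n c_mid by (subst sum.insert) (auto simp: c_top[simplified] c_low \<sigma>_def)
  also have "\<dots> \<le> (\<Sum>m\<le>2 * n. (norm (c m))\<^sup>2)"
    by (intro sum_mono2) auto
  also have "\<dots> \<le> (\<Sum>k\<le>2 * n. (norm (p k))\<^sup>2)"
    unfolding c_def by (rule toeplitz_contraction[OF f a])
  also have "\<dots> = (\<Sum>k\<in>insert 0 (insert n {n<..2 * n}). (norm (p k))\<^sup>2)"
    by (intro sum.mono_neutral_right) (auto simp: p_def)
  also have "\<dots> = 1 + (\<mu>\<^sup>2 * (norm (a n))\<^sup>2 + (\<Sum>k\<in>{n<..2 * n}. (norm (p k))\<^sup>2))"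
    using n u(1) by (subst sum.insert) (auto simp: p_def norm_mult power_mult_distrib)
  also have "(\<Sum>k\<in>{n<..2 * n}. (norm (p k))\<^sup>2) = \<sigma>"
    unfolding \<sigma>_def using u(1)
    by (intro sum.reindex_bij_witness[of _ "\<lambda>k. 2 * n - k" "\<lambda>k. 2 * n - k"])
       (auto simp: p_def norm_mult)
  finally have "norm (a (2 * n)) + \<mu> * (norm (a n))\<^sup>2 + \<sigma> \<le> 1"
    by (simp add: power_le_one_iff abs_square_le_1)
  then show ?thesis by (simp add: \<sigma>_def \<mu>_def)
qed

text \<open>The last summand is what is left of the right-hand side after \<open>n\<close> applications of both coefficient
  inequalities; with it the induction step is an identity up to these two inequalities.\<close>

lemma refined_bohr_partial_sum:
  fixes r :: real
  assumes f: "\<And>z. z \<in> ball 0 1 \<Longrightarrow> norm (f z) \<le> 1" and a: "has_disc_expansion f a"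
    and r: "0 \<le> r" "r < 1"
  shows "(\<Sum>j<2 * n. norm (a (j + 2)) * r ^ (j + 2))
      + (1 / (1 + norm (a 0)) + r / (1 - r)) * (\<Sum>k<n. (norm (a (k + 1)))\<^sup>2 * r ^ (2 * (k + 1)))
      + (1 - (\<Sum>k\<le>n. (norm (a k))\<^sup>2)) * r ^ (2 * n + 2) / (1 - r)
      \<le> (1 - (norm (a 0))\<^sup>2) * (r\<^sup>2 / (1 - r))"
proof (induction n)
  case 0
  then show ?case by (simp add: power2_eq_square)
next
  case (Suc n)
  define D where "D = 1 - (\<Sum>k\<le>n. (norm (a k))\<^sup>2)"
  define s where "s = (norm (a (n + 1)))\<^sup>2"
  define q where "q = r ^ (2 * n + 2)"
  define \<mu> where "\<mu> = 1 / (1 + norm (a 0))"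
  have q: "q \<ge> 0" using r by (simp add: q_def)
  have even: "norm (a (2 * n + 2)) \<le> D - s * \<mu>"
    using norm_coeff_even_le[OF f a, of "n + 1"] by (simp add: D_def s_def \<mu>_def lessThan_Suc_atMost)
  have odd: "norm (a (2 * n + 3)) \<le> D - s"
    using norm_coeff_odd_le[OF f a, of "n + 1"] by (simp add: D_def s_def numeral_3_eq_3)
  have "norm (a (2 * n + 2)) * q \<le> (D - s * \<mu>) * q"
    using even q by (rule mult_right_mono)
  moreover have "norm (a (2 * n + 3)) * (q * r) \<le> (D - s) * (q * r)"
    using odd q r by (intro mult_right_mono) auto
  \<comment> \<open>The coefficients of D sum to 1 + r + r^2 / (1 - r) = 1 / (1 - r), and all terms
    in s cancel. This cancellation explains the weight \<mu> + r / (1 - r) of the quadratic sum in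
    the functional.\<close>
  moreover have "(D - s * \<mu>) * q + (D - s) * (q * r) + (\<mu> + r / (1 - r)) * (s * q)
      + (D - s) * (q * r\<^sup>2) / (1 - r) = D * q / (1 - r)"
    using r by (simp add: divide_simps) (simp add: algebra_simps power2_eq_square)
  ultimately have step: "norm (a (2 * n + 2)) * q + norm (a (2 * n + 3)) * (q * r)
      + (\<mu> + r / (1 - r)) * (s * q) + (D - s) * (q * r\<^sup>2) / (1 - r) \<le> D * q / (1 - r)"
    by linarith
  have "(\<Sum>j<2 * Suc n. norm (a (j + 2)) * r ^ (j + 2)) = (\<Sum>j<2 * n. norm (a (j + 2)) * r ^ (j + 2))
      + norm (a (2 * n + 2)) * q + norm (a (2 * n + 3)) * (q * r)"
    by (simp add: q_def mult_ac numeral_3_eq_3)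
  moreover have "(\<Sum>k<Suc n. (norm (a (k + 1)))\<^sup>2 * r ^ (2 * (k + 1))) =
      (\<Sum>k<n. (norm (a (k + 1)))\<^sup>2 * r ^ (2 * (k + 1))) + s * q"
    by (simp add: s_def q_def)
  moreover have "1 - (\<Sum>k\<le>Suc n. (norm (a k))\<^sup>2) = D - s"
    by (simp add: D_def s_def)
  moreover have "r ^ (2 * Suc n + 2) = q * r\<^sup>2"
    by (simp add: q_def power2_eq_square)
  ultimately show ?case
    using Suc.IH step unfolding D_def[symmetric] q_def[symmetric] \<mu>_def[symmetric]
    by (simp only: ring_distribs)
qed

lemma refined_bohr_inequality:
  fixes r :: real
  assumes f: "\<And>z. z \<in> ball 0 1 \<Longrightarrow> norm (f z) \<le> 1" and a: "has_disc_expansion f a"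
    and r: "0 \<le> r" "r < 1"
  shows "(\<Sum>n. norm (a (n + 2)) * r ^ (n + 2))
      + (1 / (1 + norm (a 0)) + r / (1 - r)) * (\<Sum>n. (norm (a (n + 1)))\<^sup>2 * r ^ (2 * (n + 1)))
      \<le> (1 - (norm (a 0))\<^sup>2) * (r\<^sup>2 / (1 - r))" (is "?lhs \<le> ?rhs")
proof -
  define C where "C = 1 / (1 + norm (a 0)) + r / (1 - r)"
  define A where "A = (\<lambda>j. norm (a (j + 2)) * r ^ (j + 2))"
  define B where "B = (\<lambda>k. (norm (a (k + 1)))\<^sup>2 * r ^ (2 * (k + 1)))"
  have C: "C > 0" unfolding C_def
    using r norm_ge_zero[of "a 0"] by (intro add_pos_nonneg) (auto intro: add_pos_nonneg)
  have A0: "A j \<ge> 0" and B0: "B j \<ge> 0" for j using r by (auto simp: A_def B_def)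
  have partial: "sum A {..<2 * n} + C * sum B {..<n} \<le> ?rhs" for n
  proof -
    \<comment> \<open>The remainder of the partial sum estimate may be dropped: by the odd
      inequality its factor dominates a norm.\<close>
    have "0 \<le> 1 - (\<Sum>k\<le>n. (norm (a k))\<^sup>2)"
      using norm_coeff_odd_le[OF f a, of n] norm_ge_zero[of "a (2 * n + 1)"] by linarith
    then have "0 \<le> (1 - (\<Sum>k\<le>n. (norm (a k))\<^sup>2)) * r ^ (2 * n + 2) / (1 - r)"
      using r by simp
    with refined_bohr_partial_sum[OF f a r, of n] show ?thesis
      unfolding A_def B_def C_def by linarith
  qed
  have "summable A"
    unfolding A_def using disc_expansion_abs_summable[OF a r] by (rule summable_ignore_initial_segment)
  then have "(\<lambda>n. sum A {..<n}) \<longlonglongrightarrow> suminf A"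
    using summable_LIMSEQ by blast
  then have lim_A: "(\<lambda>n. sum A {..<2 * n}) \<longlonglongrightarrow> suminf A"
    using LIMSEQ_subseq_LIMSEQ[of _ _ "\<lambda>n. 2 * n"] by (simp add: strict_mono_def comp_def)
  \<comment> \<open>Summability of the squares comes from the estimate itself, since C is positive
    and the A-part is nonnegative.\<close>
  have "summable B"
  proof (rule summableI_nonneg_bounded)
    show "sum B {..<n} \<le> ?rhs / C" for n
    proof -
      have "C * sum B {..<n} \<le> ?rhs"
        using partial[of n] sum_nonneg[of "{..<2 * n}" A, OF A0]
        by (meson le_add_same_cancel2 order_trans)
      then show ?thesis by (subst pos_le_divide_eq[OF C]) (simp only: mult.commute)
    qed
  qed (rule B0)
  then have lim_B: "(\<lambda>n. sum B {..<n}) \<longlonglongrightarrow> suminf B"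
    using summable_LIMSEQ by blast
  have "suminf A + C * suminf B \<le> ?rhs"
    by (rule LIMSEQ_le_const2[OF tendsto_add[OF lim_A tendsto_mult_left[OF lim_B]]])
       (use partial in auto)
  then show ?thesis by (simp add: A_def B_def C_def)
qed

subsection \<open>The Schwarz-Pick lemma\<close>

lemma disc_mult_neq_1:
  fixes w v :: complex
  assumes "norm w < 1" "norm v < 1"
  shows "1 - cnj w * v \<noteq> 0"
proof -
  have "norm (cnj w * v) < 1" using norm_mult_less[of "cnj w" 1 v 1] assms by simp
  then show ?thesis by auto
qed

lemma Moebius_function_has_field_derivative:
  assumes "norm w < 1" "norm v < 1"
  shows "(Moebius_function 0 w has_field_derivative (1 - of_real ((norm w)\<^sup>2)) / (1 - cnj w * v)\<^sup>2) (at v)"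
proof -
  have "((\<lambda>z. (z - w) / (1 - cnj w * z)) has_field_derivative
      (1 - of_real ((norm w)\<^sup>2)) / (1 - cnj w * v)\<^sup>2) (at v)"
    unfolding complex_norm_square using disc_mult_neq_1[OF assms]
    by (auto intro!: derivative_eq_intros) (simp add: power2_eq_square algebra_simps)
  then show ?thesis by (simp add: Moebius_function_simple[abs_def])
qed

text \<open>A pseudohyperbolic ball about w reaches farthest from the origin in the direction of w,
  so it suffices to compare moduli.\<close>

lemma norm_le_of_norm_Moebius_le:
  assumes "norm w < 1" "norm v < 1" "norm (Moebius_function 0 w v) \<le> r" "0 \<le> r" "r < 1"
  shows "norm v \<le> (norm w + r) / (1 + norm w * r)"
proof -
  define a x where "a = norm w" and "x = norm v"
  have ax: "0 \<le> a" "a < 1" "0 \<le> x" "x < 1" using assms by (auto simp: a_def x_def)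
  have "a * x \<le> a * 1" using ax by (intro mult_left_mono) auto
  then have ax1: "0 \<le> 1 - a * x" using ax by linarith
  have "norm (v - w) \<le> r * norm (1 - cnj w * v)"
    using assms disc_mult_neq_1[of w v] by (simp add: Moebius_function_simple norm_divide divide_simps)
  then have 1: "(norm (v - w))\<^sup>2 \<le> r\<^sup>2 * (norm (1 - cnj w * v))\<^sup>2"
    by (metis norm_ge_zero power_mono power_mult_distrib)
  \<comment> \<open>This identity holds for v, w and equally for the moduli x, a. The complex
    version eliminates |v - w|, the real one then brings in x - a.\<close>
  have "complex_of_real ((norm (1 - cnj w * v))\<^sup>2 - (norm (v - w))\<^sup>2) =
        of_real ((1 - (norm w)\<^sup>2) * (1 - (norm v)\<^sup>2))"
    by (simp add: complex_norm_square algebra_simps del: of_real_power)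
  then have 2: "(norm (1 - cnj w * v))\<^sup>2 - (norm (v - w))\<^sup>2 = (1 - a\<^sup>2) * (1 - x\<^sup>2)"
    by (simp only: of_real_eq_iff a_def x_def)
  have "1 - a * x \<le> norm (1 - cnj w * v)"
    using norm_triangle_ineq2[of 1 "cnj w * v"] by (simp add: norm_mult a_def x_def)
  then have "(1 - a * x)\<^sup>2 \<le> (norm (1 - cnj w * v))\<^sup>2"
    using ax1 by (rule power_mono)
  then have "(1 - r\<^sup>2) * (1 - a * x)\<^sup>2 \<le> (1 - r\<^sup>2) * (norm (1 - cnj w * v))\<^sup>2"
    using assms by (intro mult_left_mono) (auto simp: abs_square_le_1)
  also have "\<dots> \<le> (1 - a\<^sup>2) * (1 - x\<^sup>2)"
    using 1 2 by (simp add: algebra_simps)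
  finally have "(x - a)\<^sup>2 \<le> (r * (1 - a * x))\<^sup>2"
    by (simp add: algebra_simps power2_eq_square)
  then have "x - a \<le> r * (1 - a * x)"
    by (rule power2_le_imp_le) (use ax1 assms in auto)
  then have "x * (1 + a * r) \<le> a + r"
    by (simp add: algebra_simps)
  then show ?thesis
    using ax assms by (simp add: a_def[symmetric] x_def[symmetric] pos_le_divide_eq add_pos_nonneg)
qed

text \<open>Both bounds are the Schwarz lemma: for the first, f is followed by the Moebius function
  that sends f(0) to 0; for the second, it is also preceded by one that sends 0 to z, and the one
  after it sends f(z) to 0.\<close>

lemma
  fixes z :: complex
  assumes f: "f \<in> unit_disc_self_maps" and z: "norm z < 1"
  shows schwarz_pick_norm_le: "norm (f z) \<le> (norm (f 0) + norm z) / (1 + norm (f 0) * norm z)"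
    and schwarz_pick_deriv_le: "norm (deriv f z) \<le> (1 - (norm (f z))\<^sup>2) / (1 - (norm z)\<^sup>2)"
proof -
  have holf: "f holomorphic_on ball 0 1" and f1: "norm u < 1 \<Longrightarrow> norm (f u) < 1" for u
    using f by (auto simp: unit_disc_self_maps_def analytic_imp_holomorphic image_subset_iff)
  have comp: "(\<lambda>u. Moebius_function 0 w (h u)) holomorphic_on ball 0 1"
    if "h holomorphic_on ball 0 1" "\<And>u. norm u < 1 \<Longrightarrow> norm (h u) < 1" "norm w < 1" for h w
    using holomorphic_on_compose_gen[OF that(1) Moebius_function_holomorphic[OF that(3)]] that(2)
    by (auto simp: o_def image_subset_iff)
  have "(\<lambda>u. Moebius_function 0 (f 0) (f u)) holomorphic_on ball 0 1"
    using holf f1 by (intro comp) auto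
  from Schwarz_Lemma(1)[OF this _ _ z]
  have "norm (Moebius_function 0 (f 0) (f z)) \<le> norm z"
    using f1 by (simp add: Moebius_function_eq_zero Moebius_function_norm_lt_1)
  then show "norm (f z) \<le> (norm (f 0) + norm z) / (1 + norm (f 0) * norm z)"
    using f1 z by (intro norm_le_of_norm_Moebius_le) auto
  define h where "h = (\<lambda>u. f (Moebius_function 0 (- z) u))"
  define g where "g = (\<lambda>u. Moebius_function 0 (f z) (h u))"
  have h0: "h 0 = f z" by (simp add: h_def Moebius_function_of_zero)
  have M1: "norm (Moebius_function 0 (- z) u) < 1" if "norm u < 1" for u
    using that z by (intro Moebius_function_norm_lt_1) auto
  have h1: "norm (h u) < 1" if "norm u < 1" for u
    using M1[OF that] by (auto simp: h_def intro: f1)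
  have "h holomorphic_on ball 0 1"
    using holomorphic_on_compose_gen[OF Moebius_function_holomorphic[of "- z"] holf] z M1
    by (auto simp: o_def h_def image_subset_iff)
  then have holg: "g holomorphic_on ball 0 1"
    unfolding g_def using h1 f1[OF z] by (intro comp) auto
  have "norm (g u) < 1" if "norm u < 1" for u
    unfolding g_def using f1[OF z] h1[OF that] by (rule Moebius_function_norm_lt_1)
  then have "norm (deriv g 0) \<le> 1"
    using Schwarz_Lemma(2)[OF holg, of 0] by (simp add: g_def h0 Moebius_function_eq_zero)
  have dM: "(Moebius_function 0 (- z) has_field_derivative of_real (1 - (norm z)\<^sup>2)) (at 0)"
    using Moebius_function_has_field_derivative[of "- z" 0] z by simp
  have "(f has_field_derivative deriv f z) (at (Moebius_function 0 (- z) 0))"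
    using holf z by (auto simp: Moebius_function_of_zero intro!: holomorphic_derivI[of f "ball 0 1"])
  from DERIV_chain2[OF this dM]
  have dh: "(h has_field_derivative deriv f z * of_real (1 - (norm z)\<^sup>2)) (at 0)"
    by (simp add: h_def)
  have "1 - (norm (f z))\<^sup>2 > 0" using f1[OF z] by (simp add: abs_square_less_1)
  then have neq: "1 - complex_of_real ((norm (f z))\<^sup>2) \<noteq> 0"
    by (metis of_real_1 of_real_diff of_real_eq_0_iff less_irrefl)
  have "1 - cnj (f z) * f z = 1 - of_real ((norm (f z))\<^sup>2)"
    by (simp only: complex_norm_square mult.commute)
  \<comment> \<open>At its own zero the derivative (1 - |w|^2) / (1 - |w|^2)^2 collapses to 1 / (1 -
    |w|^2).\<close>
  then have "(Moebius_function 0 (f z) has_field_derivative 1 / of_real (1 - (norm (f z))\<^sup>2)) (at (h 0))"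
    using Moebius_function_has_field_derivative[of "f z" "f z"] f1[OF z] neq
    by (simp add: h0 power2_eq_square divide_simps)
  from DERIV_chain2[OF this dh]
  have "deriv g 0 = 1 / of_real (1 - (norm (f z))\<^sup>2) * (deriv f z * of_real (1 - (norm z)\<^sup>2))"
    unfolding g_def by (rule DERIV_imp_deriv)
  then have "norm (deriv g 0) = norm (deriv f z) * (1 - (norm z)\<^sup>2) / (1 - (norm (f z))\<^sup>2)"
    using f1[OF z] z
    by (simp only: norm_mult norm_divide norm_of_real norm_one) (simp add: abs_square_le_1 less_imp_le)
  with \<open>norm (deriv g 0) \<le> 1\<close> \<open>1 - (norm (f z))\<^sup>2 > 0\<close>
  have "norm (deriv f z) * (1 - (norm z)\<^sup>2) \<le> 1 - (norm (f z))\<^sup>2"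
    by (simp add: divide_simps)
  moreover have "1 - (norm z)\<^sup>2 > 0" using z by (simp add: abs_square_less_1)
  ultimately show "norm (deriv f z) \<le> (1 - (norm (f z))\<^sup>2) / (1 - (norm z)\<^sup>2)"
    by (simp add: pos_le_divide_eq)
qed

subsection \<open>The extremal function\<close>

text \<open>For 0 < a < 1 and 0 < r < 1 this is the value of the functional at -r for the disc
  automorphism (a - z) / (1 - a z).\<close>

definition bohr_majorant :: "nat \<Rightarrow> real \<Rightarrow> real \<Rightarrow> real" where
  "bohr_majorant p a r = ((a + r) / (1 + a * r)) ^ p + (1 - a\<^sup>2) * r / (1 + a * r)\<^sup>2
     + (1 - a\<^sup>2) * r\<^sup>2 / (1 - r)"

text \<open>A larger |f(z)| raises the first term but lowers the Schwarz-Pick bound on the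
  derivative. The hypothesis \<open>mono\<close> says that the gain prevails, so that |f(z)| may be
  replaced by its largest possible value X. It is left to the caller because it restricts r in a way
  that depends on p.\<close>

lemma bohr_functional_le_majorant:
  fixes z :: complex
  assumes f: "f \<in> unit_disc_self_maps" and a: "has_disc_expansion f a" and z: "norm z < 1"
    and mono: "\<And>x y. \<lbrakk>0 \<le> x; x \<le> y; y \<le> 1\<rbrakk> \<Longrightarrow>
      x ^ p + (1 - x\<^sup>2) / (1 - (norm z)\<^sup>2) * norm z \<le> y ^ p + (1 - y\<^sup>2) / (1 - (norm z)\<^sup>2) * norm z"
  shows "bohr_functional p f a z \<le> bohr_majorant p (norm (a 0)) (norm z)"
proof -
  define r where "r = norm z"
  define \<alpha> where "\<alpha> = norm (a 0)"
  define X where "X = (\<alpha> + r) / (1 + \<alpha> * r)"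
  have f1: "norm (f u) < 1" if "norm u < 1" for u
    using f that by (auto simp: unit_disc_self_maps_def image_subset_iff)
  have f0: "f 0 = a 0"
    using disc_expansion_coeff_0[OF a] by simp
  have r: "0 \<le> r" "r < 1" and \<alpha>: "0 \<le> \<alpha>" "\<alpha> < 1"
    using z f1[of 0] f0 by (auto simp: r_def \<alpha>_def)
  have pos: "1 + \<alpha> * r > 0" using r \<alpha> by (intro add_pos_nonneg) auto
  have r2: "1 - r\<^sup>2 > 0" using r by (simp add: abs_square_less_1)
  have "(1 - \<alpha>) * (1 - r) \<ge> 0" using r \<alpha> by simp
  then have X1: "X \<le> 1" using pos by (simp add: X_def algebra_simps)
  have "norm (f z) ^ p + norm (deriv f z) * r
      \<le> norm (f z) ^ p + (1 - (norm (f z))\<^sup>2) / (1 - r\<^sup>2) * r"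
    using schwarz_pick_deriv_le[OF f z] r by (intro add_left_mono mult_right_mono) (auto simp: r_def)
  also have "\<dots> \<le> X ^ p + (1 - X\<^sup>2) / (1 - r\<^sup>2) * r"
    unfolding r_def using schwarz_pick_norm_le[OF f z] X1
    by (intro mono) (auto simp: X_def r_def \<alpha>_def f0)
  \<comment> \<open>The factor 1 - r^2 cancels the denominator of the derivative bound.\<close>
  also have "1 - X\<^sup>2 = (1 - \<alpha>\<^sup>2) * (1 - r\<^sup>2) / (1 + \<alpha> * r)\<^sup>2"
    using pos by (simp add: X_def divide_simps) (simp add: algebra_simps power2_eq_square)
  also have "\<dots> / (1 - r\<^sup>2) * r = (1 - \<alpha>\<^sup>2) * r / (1 + \<alpha> * r)\<^sup>2"
    using r2 by simp
  finally have "norm (f z) ^ p + norm (deriv f z) * r \<le> X ^ p + (1 - \<alpha>\<^sup>2) * r / (1 + \<alpha> * r)\<^sup>2" .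
  moreover have "(\<Sum>n. norm (a (n + 2)) * r ^ (n + 2))
      + (1 / (1 + \<alpha>) + r / (1 - r)) * (\<Sum>n. (norm (a (n + 1)))\<^sup>2 * r ^ (2 * (n + 1)))
      \<le> (1 - \<alpha>\<^sup>2) * (r\<^sup>2 / (1 - r))"
    unfolding \<alpha>_def using f1 by (intro refined_bohr_inequality[OF _ a r]) (auto intro: less_imp_le)
  ultimately show ?thesis
    unfolding bohr_functional_def bohr_majorant_def Let_def X_def \<alpha>_def r_def by simp
qed

text \<open>The automorphism (a - z) / (1 - a z) attains the majorant at -r, where its value is
  positive and its derivative largest allowed; both series are geometric.\<close>

lemma bohr_majorant_le_1_if_upto:
  assumes "bohr_inequality_upto p R" and a: "0 < a" "a < 1" and r: "0 < r" "r < 1" "r \<le> R"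
  shows "bohr_majorant p a r \<le> 1"
proof -
  define f :: "complex \<Rightarrow> complex" where "f = (\<lambda>z. (of_real a - z) / (1 - of_real a * z))"
  \<comment> \<open>Coefficients of a - (1 - a^2) z / (1 - a z), expanded geometrically.\<close>
  define b :: "nat \<Rightarrow> real" where "b = (\<lambda>n. if n = 0 then a else - (1 - a\<^sup>2) * a ^ (n - 1))"
  have a2: "a\<^sup>2 < 1" using a by (simp add: abs_square_less_1)
  have "a * r < 1 * 1" using a r by (intro mult_strict_mono) auto
  then have ar: "a * r < 1" by simp
  have f_Moebius: "f z = - Moebius_function 0 (of_real a) z" for z
    by (simp add: f_def Moebius_function_simple minus_divide_left)
  have neq: "1 - of_real a * z \<noteq> 0" if "norm z < 1" for z :: complex
    using disc_mult_neq_1[of "of_real a" z] that a by simp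
  have "f analytic_on ball 0 1"
    unfolding f_def using neq
    by (subst analytic_on_open) (auto intro!: holomorphic_intros)
  moreover have "norm (f z) < 1" if "norm z < 1" for z :: complex
    using Moebius_function_norm_lt_1[of "of_real a" z 0] that a by (simp add: f_Moebius)
  ultimately have fin: "f \<in> unit_disc_self_maps"
    by (auto simp: unit_disc_self_maps_def)
  have exp: "has_disc_expansion f (\<lambda>n. of_real (b n))"
    unfolding has_disc_expansion_def
  proof
    fix z :: complex assume "z \<in> ball 0 1"
    then have z: "norm z < 1" by simp
    have "norm (of_real a * z) < 1" using norm_mult_less[of "of_real a" 1 z 1] a z by simp
    from sums_mult[OF geometric_sums[OF this], of "- of_real (1 - a\<^sup>2) * z"]
    have "(\<lambda>n. of_real (b (Suc n)) * z ^ Suc n) sums (- of_real (1 - a\<^sup>2) * z / (1 - of_real a * z))"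
      by (simp add: b_def power_mult_distrib mult_ac)
    from sums_Suc[OF this]
    have "(\<lambda>n. of_real (b n) * z ^ n) sums (- of_real (1 - a\<^sup>2) * z / (1 - of_real a * z) + of_real a)"
      by (simp add: b_def)
    also have "- of_real (1 - a\<^sup>2) * z / (1 - of_real a * z) + of_real a = f z"
      using neq[OF z] by (simp add: f_def divide_simps) (simp add: algebra_simps power2_eq_square)
    finally show "(\<lambda>n. of_real (b n) * z ^ n) sums f z" .
  qed
  have pos: "1 + a * r > 0" using a r by (intro add_pos_nonneg) auto
  have f_val: "f (- of_real r) = of_real ((a + r) / (1 + a * r))"
    by (simp add: f_def)
  have dval: "deriv f (- of_real r) = of_real (- (1 - a\<^sup>2) / (1 + a * r)\<^sup>2)"
  proof -
    have "(f has_field_derivative of_real (- (1 - a\<^sup>2) / (1 + a * r)\<^sup>2)) (at (- of_real r))"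
      unfolding f_def using neq[of "- of_real r"] r
      by (auto intro!: derivative_eq_intros simp: power2_eq_square algebra_simps minus_divide_left)
    then show ?thesis by (rule DERIV_imp_deriv)
  qed
  have norm_b: "norm (complex_of_real (b (Suc n))) = (1 - a\<^sup>2) * a ^ n" for n
    unfolding norm_of_real using a a2 by (simp add: b_def abs_mult)
  have "(\<lambda>n. norm (complex_of_real (b (n + 2))) * r ^ (n + 2)) = (\<lambda>n. (1 - a\<^sup>2) * a * r\<^sup>2 * (a * r) ^ n)"
    by (simp add: norm_b power_mult_distrib power2_eq_square mult_ac fun_eq_iff del: norm_of_real)
  then have S1: "(\<Sum>n. norm (complex_of_real (b (n + 2))) * r ^ (n + 2)) = (1 - a\<^sup>2) * a * r\<^sup>2 * (1 / (1 - a * r))"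
    using sums_mult[OF geometric_sums[of "a * r"], of "(1 - a\<^sup>2) * a * r\<^sup>2"] a r ar by (simp add: sums_iff)
  have "(a * r)\<^sup>2 < 1" using ar a r by (simp add: abs_square_less_1 del: power_mult_distrib)
  moreover have "(\<lambda>n. (norm (complex_of_real (b (n + 1))))\<^sup>2 * r ^ (2 * (n + 1))) =
      (\<lambda>n. (1 - a\<^sup>2)\<^sup>2 * r\<^sup>2 * ((a * r)\<^sup>2) ^ n)"
    by (simp add: norm_b power_mult_distrib power2_eq_square power_mult power_add mult_ac fun_eq_iff del: norm_of_real)
  ultimately have S2: "(\<Sum>n. (norm (complex_of_real (b (n + 1))))\<^sup>2 * r ^ (2 * (n + 1))) =
      (1 - a\<^sup>2)\<^sup>2 * r\<^sup>2 * (1 / (1 - (a * r)\<^sup>2))"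
    using sums_mult[OF geometric_sums[of "(a * r)\<^sup>2"], of "(1 - a\<^sup>2)\<^sup>2 * r\<^sup>2"] by (simp add: sums_iff)
  have b0: "norm (complex_of_real (b 0)) = a" using a by (simp add: b_def)
  \<comment> \<open>The weight equals (1 + a r) / ((1 + a)(1 - r)), so the factors 1 + a and 1 + a r
    cancel and the two series combine to exactly the refined Bohr bound.\<close>
  have "(1 - (a * r)\<^sup>2) = (1 - a * r) * (1 + a * r)" by (simp add: algebra_simps power2_eq_square)
  then have "(1 - a\<^sup>2) * a * r\<^sup>2 * (1 / (1 - a * r))
      + (1 / (1 + a) + r / (1 - r)) * ((1 - a\<^sup>2)\<^sup>2 * r\<^sup>2 * (1 / (1 - (a * r)\<^sup>2)))
      = (1 - a\<^sup>2) * r\<^sup>2 * (a / (1 - a * r)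
        + (1 + a * r) / ((1 + a) * (1 - r)) * ((1 + a) * (1 - a) / ((1 - a * r) * (1 + a * r))))"
    using a r by (simp add: divide_simps) (simp add: algebra_simps power2_eq_square)
  also have "\<dots> = (1 - a\<^sup>2) * r\<^sup>2 * (a / (1 - a * r) + (1 - a) / ((1 - r) * (1 - a * r)))"
    using a r pos by simp
  also have "a / (1 - a * r) + (1 - a) / ((1 - r) * (1 - a * r)) = 1 / (1 - r)"
    using r ar by (simp add: divide_simps) (simp add: algebra_simps)
  finally have tail: "(1 - a\<^sup>2) * a * r\<^sup>2 * (1 / (1 - a * r))
      + (1 / (1 + a) + r / (1 - r)) * ((1 - a\<^sup>2)\<^sup>2 * r\<^sup>2 * (1 / (1 - (a * r)\<^sup>2)))
      = (1 - a\<^sup>2) * r\<^sup>2 / (1 - r)" by simp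
  have n: "norm (- complex_of_real r) = r" using r by simp
  have nf: "norm (f (- of_real r)) = (a + r) / (1 + a * r)"
    unfolding f_val norm_of_real using a r pos by simp
  have nd: "norm (deriv f (- of_real r)) = (1 - a\<^sup>2) / (1 + a * r)\<^sup>2"
    unfolding dval norm_of_real using a2 by simp
  have "bohr_functional p f (\<lambda>n. of_real (b n)) (- of_real r) = bohr_majorant p a r"
    unfolding bohr_functional_def bohr_majorant_def Let_def n nf nd S1 S2 b0 using tail by simp
  moreover have "bohr_functional p f (\<lambda>n. of_real (b n)) (- of_real r) \<le> 1"
    using assms(1) fin exp r n by (auto simp: bohr_inequality_upto_def)
  ultimately show ?thesis by simp
qed

subsection \<open>The critical radii\<close>

text \<open>The majorant is 1 at a = 1, so 1 - a splits off, and for a < 1 the sign is that of the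
  last bracket. At a = 1 this bracket is (1 - 3r - 2r^2)(1 + r^2), which yields the first critical
  radius.\<close>

lemma one_minus_bohr_majorant_1:
  assumes "0 \<le> a" "0 \<le> r" "r < 1"
  shows "1 - bohr_majorant 1 a r = (1 - a) / ((1 + a * r)\<^sup>2 * (1 - r)) *
    ((1 - r)\<^sup>2 * (1 + a * r) - r * (1 + a) * (1 - r) - (1 + a) * r\<^sup>2 * (1 + a * r)\<^sup>2)"
proof -
  have "1 + a * r > 0" using assms by (intro add_pos_nonneg) auto
  then show ?thesis
    using assms unfolding bohr_majorant_def
    by (simp add: divide_simps) (simp add: algebra_simps power2_eq_square)
qed

text \<open>For p = 2 even 1 - a^2 splits off; at a = 1 the bracket is the quartic 1 - 2r - r^2 -
  r^3 - r^4.\<close>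

lemma one_minus_bohr_majorant_2:
  assumes "0 \<le> a" "0 \<le> r" "r < 1"
  shows "1 - bohr_majorant 2 a r = (1 - a\<^sup>2) / ((1 + a * r)\<^sup>2 * (1 - r)) *
    ((1 - r - r\<^sup>2) * (1 - r) - r\<^sup>2 * (1 + a * r)\<^sup>2)"
proof -
  have "1 + a * r > 0" using assms by (intro add_pos_nonneg) auto
  then show ?thesis
    using assms unfolding bohr_majorant_def
    by (simp add: divide_simps) (simp add: algebra_simps power2_eq_square)
qed

lemma bohr_majorant_1_le_1:
  assumes a: "0 \<le> a" "a \<le> 1" and r: "0 \<le> r" "r < 1" and R: "3 * r + 2 * r\<^sup>2 \<le> 1"
  shows "bohr_majorant 1 a r \<le> 1"
proof -
  have "(1 + a) * (1 + a * r)\<^sup>2 \<le> (1 + 1) * (1 + 1 * r)\<^sup>2"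
    using a r by (intro mult_mono power_mono add_mono mult_right_mono) auto
  then have "r\<^sup>2 * ((1 + a) * (1 + a * r)\<^sup>2) \<le> r\<^sup>2 * (2 * (1 + r)\<^sup>2)"
    by (intro mult_left_mono) auto
  \<comment> \<open>The first two terms of the bracket equal (1 - r)(1 - 2r - a r^2), which exceeds
    its value at a = 1 by this amount. So a = 1 is the worst case, settled by the factored value
    below.\<close>
  moreover have "0 \<le> (1 - a) * (r\<^sup>2 * (1 - r))"
    using a r by simp
  moreover have "0 \<le> (1 - 3 * r - 2 * r\<^sup>2) * (1 + r\<^sup>2)"
    using R by simp
  ultimately have "0 \<le> (1 - r)\<^sup>2 * (1 + a * r) - r * (1 + a) * (1 - r) - (1 + a) * r\<^sup>2 * (1 + a * r)\<^sup>2"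
    by (simp add: algebra_simps power2_eq_square)
  then have "0 \<le> 1 - bohr_majorant 1 a r"
    unfolding one_minus_bohr_majorant_1[OF a(1) r] using a r by simp
  then show ?thesis by simp
qed

lemma bohr_majorant_2_le_1:
  assumes a: "0 \<le> a" "a \<le> 1" and r: "0 \<le> r" "r < 1" and R: "2 * r + r ^ 2 + r ^ 3 + r ^ 4 \<le> 1"
  shows "bohr_majorant 2 a r \<le> 1"
proof -
  have "(1 + a * r)\<^sup>2 \<le> (1 + 1 * r)\<^sup>2"
    using a r by (intro power_mono add_mono mult_right_mono) auto
  then have "r\<^sup>2 * (1 + a * r)\<^sup>2 \<le> r\<^sup>2 * (1 + r)\<^sup>2"
    by (intro mult_left_mono) auto
  then have "0 \<le> (1 - r - r\<^sup>2) * (1 - r) - r\<^sup>2 * (1 + a * r)\<^sup>2"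
    using R by (simp add: algebra_simps power2_eq_square power3_eq_cube power4_eq_xxxx)
  then have "0 \<le> 1 - bohr_majorant 2 a r"
    unfolding one_minus_bohr_majorant_2[OF a(1) r] using a r by (simp add: abs_square_le_1)
  then show ?thesis by simp
qed

section \<open>Validity up to the critical radii\<close>

lemma bohr_inequality_upto_1:
  assumes R: "3 * R + 2 * R\<^sup>2 \<le> 1" "R \<ge> 0"
  shows "bohr_inequality_upto 1 R"
  unfolding bohr_inequality_upto_def
proof (intro ballI allI impI)
  fix f :: "complex \<Rightarrow> complex" and a and z :: complex
  assume f: "f \<in> unit_disc_self_maps" and a: "has_disc_expansion f a"
    and z: "z \<in> ball 0 1" "norm z \<le> R"
  define r where "r = norm z"
  have r: "0 \<le> r" "r < 1" "r \<le> R" using z by (auto simp: r_def)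
  have "r\<^sup>2 \<le> R\<^sup>2" using r by (intro power_mono) auto
  then have r_le: "3 * r + 2 * r\<^sup>2 \<le> 1" using R r by linarith
  have r2: "1 - r\<^sup>2 > 0" using r by (simp add: abs_square_less_1)
  have 0: "2 * r \<le> 1 - r\<^sup>2" using r_le zero_le_power2[of r] r(1) by linarith
  have "bohr_functional 1 f a z \<le> bohr_majorant 1 (norm (a 0)) r"
    unfolding r_def
  proof (rule bohr_functional_le_majorant[OF f a])
    fix x y :: real assume xy: "0 \<le> x" "x \<le> y" "y \<le> 1"
    have "(x + y) * r \<le> 2 * r" using xy r by (intro mult_right_mono) auto
    \<comment> \<open>The increment of x (1 - r^2) + (1 - x^2) r from x to y; since x + y \<le> 2,
      monotonicity only requires 2r \<le> 1 - r^2.\<close>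
    then have "0 \<le> (y - x) * ((1 - r\<^sup>2) - (x + y) * r)"
      using 0 xy by (intro mult_nonneg_nonneg) auto
    then have "x * (1 - r\<^sup>2) + (1 - x\<^sup>2) * r \<le> y * (1 - r\<^sup>2) + (1 - y\<^sup>2) * r"
      by (simp add: algebra_simps power2_eq_square)
    then show "x ^ 1 + (1 - x\<^sup>2) / (1 - (norm z)\<^sup>2) * norm z \<le> y ^ 1 + (1 - y\<^sup>2) / (1 - (norm z)\<^sup>2) * norm z"
      unfolding r_def[symmetric] using r2 by (simp add: divide_simps)
  qed (use z in simp)
  also have "\<dots> \<le> 1"
    using f r r_le disc_expansion_coeff_0[OF a]
    by (intro bohr_majorant_1_le_1)
       (auto simp: unit_disc_self_maps_def image_subset_iff intro: less_imp_le)
  finally show "bohr_functional 1 f a z \<le> 1" .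
qed

lemma bohr_inequality_upto_2:
  assumes R: "2 * R + R ^ 2 + R ^ 3 + R ^ 4 \<le> 1" "R \<ge> 0"
  shows "bohr_inequality_upto 2 R"
  unfolding bohr_inequality_upto_def
proof (intro ballI allI impI)
  fix f :: "complex \<Rightarrow> complex" and a and z :: complex
  assume f: "f \<in> unit_disc_self_maps" and a: "has_disc_expansion f a"
    and z: "z \<in> ball 0 1" "norm z \<le> R"
  define r where "r = norm z"
  have r: "0 \<le> r" "r < 1" "r \<le> R" using z by (auto simp: r_def)
  have "r ^ 2 \<le> R ^ 2" "r ^ 3 \<le> R ^ 3" "r ^ 4 \<le> R ^ 4" using r by (auto intro: power_mono)
  then have r_le: "2 * r + r ^ 2 + r ^ 3 + r ^ 4 \<le> 1" using R r by linarith
  have r2: "1 - r\<^sup>2 > 0" using r by (simp add: abs_square_less_1)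
  have "0 \<le> r ^ 3" "0 \<le> r ^ 4" using r by auto
  then have 0: "r \<le> 1 - r\<^sup>2" using r_le r(1) by linarith
  have "bohr_functional 2 f a z \<le> bohr_majorant 2 (norm (a 0)) r"
    unfolding r_def
  proof (rule bohr_functional_le_majorant[OF f a])
    fix x y :: real assume xy: "0 \<le> x" "x \<le> y" "y \<le> 1"
    have "0 \<le> (y\<^sup>2 - x\<^sup>2) * ((1 - r\<^sup>2) - r)"
      using 0 xy by (intro mult_nonneg_nonneg) (auto simp: power_mono)
    then have "x\<^sup>2 * (1 - r\<^sup>2) + (1 - x\<^sup>2) * r \<le> y\<^sup>2 * (1 - r\<^sup>2) + (1 - y\<^sup>2) * r"
      by (simp add: algebra_simps)
    then show "x\<^sup>2 + (1 - x\<^sup>2) / (1 - (norm z)\<^sup>2) * norm z \<le> y\<^sup>2 + (1 - y\<^sup>2) / (1 - (norm z)\<^sup>2) * norm z"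
      unfolding r_def[symmetric] using r2 by (simp add: divide_simps)
  qed (use z in simp)
  also have "\<dots> \<le> 1"
    using f r r_le disc_expansion_coeff_0[OF a]
    by (intro bohr_majorant_2_le_1)
       (auto simp: unit_disc_self_maps_def image_subset_iff intro: less_imp_le)
  finally show "bohr_functional 2 f a z \<le> 1" .
qed

section \<open>Sharpness of the radii\<close>

text \<open>H stands for the bracket left after splitting off the factor that vanishes at a = 1. The
  majorant itself tends to 1, so only the limit of the bracket shows that it exceeds 1 for a close
  to 1.\<close>

lemma not_bohr_inequality_upto:
  fixes H :: "real \<Rightarrow> real"
  assumes r: "0 < r" "r < 1" "r \<le> R" and H: "H \<midarrow>1\<rightarrow> h" "h < 0"
    and majorant: "\<And>a. \<lbrakk>0 < a; a < 1; H a < 0\<rbrakk> \<Longrightarrow> 1 < bohr_majorant p a r"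
  shows "\<not> bohr_inequality_upto p R"
proof
  assume *: "bohr_inequality_upto p R"
  have "eventually (\<lambda>a. H a < 0) (at_left 1)"
    by (rule order_tendstoD(2)[OF tendsto_mono[OF at_le H(1)] H(2)]) simp
  moreover have "eventually (\<lambda>a. 0 < a \<and> a < (1::real)) (at_left 1)"
    using eventually_at_left_real[of 0 1] by simp
  ultimately have "eventually (\<lambda>a::real. False) (at_left 1)"
    by eventually_elim (use majorant bohr_majorant_le_1_if_upto[OF * _ _ r] in force)
  then show False by simp
qed

lemma not_bohr_inequality_upto_1:
  assumes "1 < 3 * R0 + 2 * R0\<^sup>2" "0 < R0" "R0 < 1" "R0 \<le> R"
  shows "\<not> bohr_inequality_upto 1 R"
proof (rule not_bohr_inequality_upto[of R0])
  define H where "H = (\<lambda>a. (1 - R0)\<^sup>2 * (1 + a * R0) - R0 * (1 + a) * (1 - R0)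
    - (1 + a) * R0\<^sup>2 * (1 + a * R0)\<^sup>2)"
  show "H \<midarrow>1\<rightarrow> H 1" unfolding H_def by (auto intro!: tendsto_eq_intros)
  have "H 1 = (1 - 3 * R0 - 2 * R0\<^sup>2) * (1 + R0\<^sup>2)"
    by (simp add: H_def algebra_simps power2_eq_square)
  then show "H 1 < 0" using assms by (simp add: mult_neg_pos add_pos_nonneg)
  fix a :: real assume a: "0 < a" "a < 1" "H a < 0"
  have "1 + a * R0 > 0" using a assms by (intro add_pos_nonneg) auto
  then have "(1 - a) / ((1 + a * R0)\<^sup>2 * (1 - R0)) * H a < 0"
    using a assms by (intro mult_pos_neg divide_pos_pos mult_pos_pos) auto
  then show "1 < bohr_majorant 1 a R0"
    using one_minus_bohr_majorant_1[of a R0] a assms by (simp add: H_def)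
qed (use assms in auto)

lemma not_bohr_inequality_upto_2:
  assumes "1 < 2 * R0 + R0 ^ 2 + R0 ^ 3 + R0 ^ 4" "0 < R0" "R0 < 1" "R0 \<le> R"
  shows "\<not> bohr_inequality_upto 2 R"
proof (rule not_bohr_inequality_upto[of R0])
  define H where "H = (\<lambda>a. (1 - R0 - R0\<^sup>2) * (1 - R0) - R0\<^sup>2 * (1 + a * R0)\<^sup>2)"
  show "H \<midarrow>1\<rightarrow> H 1" unfolding H_def by (auto intro!: tendsto_eq_intros)
  have "H 1 = 1 - (2 * R0 + R0 ^ 2 + R0 ^ 3 + R0 ^ 4)"
    by (simp add: H_def algebra_simps power2_eq_square power3_eq_cube power4_eq_xxxx)
  then show "H 1 < 0" using assms by simp
  fix a :: real assume a: "0 < a" "a < 1" "H a < 0"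
  have "1 + a * R0 > 0" using a assms by (intro add_pos_nonneg) auto
  then have "(1 - a\<^sup>2) / ((1 + a * R0)\<^sup>2 * (1 - R0)) * H a < 0"
    using a assms by (intro mult_pos_neg divide_pos_pos mult_pos_pos) (auto simp: abs_square_less_1)
  then show "1 < bohr_majorant 2 a R0"
    using one_minus_bohr_majorant_2[of a R0] a assms by (simp add: H_def)
qed (use assms in auto)

lemma quartic_strict_mono:
  fixes x y :: real
  assumes "0 \<le> x" "x < y"
  shows "2 * x + x ^ 2 + x ^ 3 + x ^ 4 < 2 * y + y ^ 2 + y ^ 3 + y ^ 4"
  using assms by (intro add_strict_mono power_strict_mono) auto

theorem theorem7:
  shows "(bohr_inequality_upto 1 ((sqrt 17 - 3) / 4) \<and>
          (\<forall>R > (sqrt 17 - 3) / 4. \<not> bohr_inequality_upto 1 R)) \<and>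
         (\<exists>r\<^sub>0::real. r\<^sub>0 > 0 \<and> 1 - 2 * r\<^sub>0 - r\<^sub>0 ^ 2 - r\<^sub>0 ^ 3 - r\<^sub>0 ^ 4 = 0 \<and>
            (\<forall>x>0. 1 - 2 * x - x ^ 2 - x ^ 3 - x ^ 4 = 0 \<longrightarrow> x = r\<^sub>0) \<and>
            \<bar>r\<^sub>0 - 0.385795\<bar> \<le> 5 / 10 ^ 7 \<and>
            bohr_inequality_upto 2 r\<^sub>0 \<and>
            (\<forall>R > r\<^sub>0. \<not> bohr_inequality_upto 2 R))"
proof (intro conjI)
  define R1 where "R1 = (sqrt 17 - 3) / 4"
  have "3 < sqrt 17" by (rule real_less_rsqrt) simp
  moreover have "sqrt 17 < 5" by (rule real_less_lsqrt) auto
  ultimately have R1: "0 < R1" "R1 < 1" by (auto simp: R1_def)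
  have R1_root: "3 * R1 + 2 * R1\<^sup>2 = 1"
    by (simp add: R1_def power2_eq_square field_simps)
  show "bohr_inequality_upto 1 ((sqrt 17 - 3) / 4)"
    using bohr_inequality_upto_1[of R1] R1 R1_root by (simp add: R1_def)
  show "\<forall>R > (sqrt 17 - 3) / 4. \<not> bohr_inequality_upto 1 R"
    unfolding R1_def[symmetric]
  proof (intro allI impI)
    fix R assume "R > R1"
    \<comment> \<open>R may be 1 or larger, while the extremal function is evaluated at a radius
      below 1; violation at a smaller radius suffices.\<close>
    then obtain r where r: "R1 < r" "r < min R 1" using R1 dense[of R1 "min R 1"] by auto
    have "R1\<^sup>2 < r\<^sup>2" using r R1 by (intro power_strict_mono) auto
    with R1_root r R1 show "\<not> bohr_inequality_upto 1 R"
      by (intro not_bohr_inequality_upto_1[of r]) auto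
  qed
  define q :: "real \<Rightarrow> real" where "q = (\<lambda>x. 2 * x + x ^ 2 + x ^ 3 + x ^ 4)"
  have q_mono: "q x < q y" if "0 \<le> x" "x < y" for x y
    using quartic_strict_mono[OF that] by (simp add: q_def)
  \<comment> \<open>The endpoints are 0.385795 minus and plus 5 / 10^7, so the intermediate value
    theorem gives the root and its six decimals at once.\<close>
  have "\<exists>x\<ge>0.3857945. x \<le> 0.3857955 \<and> q x = 1"
    by (rule IVT') (auto simp: q_def power_numeral_reduce intro!: continuous_intros)
  then obtain r\<^sub>0 where r\<^sub>0: "0.3857945 \<le> r\<^sub>0" "r\<^sub>0 \<le> 0.3857955" "q r\<^sub>0 = 1" by blast
  have pos: "0 < r\<^sub>0" "r\<^sub>0 < 1" using r\<^sub>0 by auto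
  show "\<exists>r\<^sub>0::real. r\<^sub>0 > 0 \<and> 1 - 2 * r\<^sub>0 - r\<^sub>0 ^ 2 - r\<^sub>0 ^ 3 - r\<^sub>0 ^ 4 = 0 \<and>
            (\<forall>x>0. 1 - 2 * x - x ^ 2 - x ^ 3 - x ^ 4 = 0 \<longrightarrow> x = r\<^sub>0) \<and>
            \<bar>r\<^sub>0 - 0.385795\<bar> \<le> 5 / 10 ^ 7 \<and>
            bohr_inequality_upto 2 r\<^sub>0 \<and>
            (\<forall>R > r\<^sub>0. \<not> bohr_inequality_upto 2 R)"
  proof (intro exI[of _ r\<^sub>0] conjI allI impI)
    show "1 - 2 * r\<^sub>0 - r\<^sub>0 ^ 2 - r\<^sub>0 ^ 3 - r\<^sub>0 ^ 4 = 0" using r\<^sub>0(3) by (simp add: q_def)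
    show "bohr_inequality_upto 2 r\<^sub>0"
      using r\<^sub>0(3) pos by (intro bohr_inequality_upto_2) (auto simp: q_def)
    show "\<bar>r\<^sub>0 - 0.385795\<bar> \<le> 5 / 10 ^ 7"
      unfolding abs_le_iff using r\<^sub>0 by simp
  next
    fix x :: real assume "x > 0" "1 - 2 * x - x ^ 2 - x ^ 3 - x ^ 4 = 0"
    then have "q x = q r\<^sub>0" using r\<^sub>0(3) by (simp add: q_def)
    then show "x = r\<^sub>0"
      using q_mono[of x r\<^sub>0] q_mono[of r\<^sub>0 x] \<open>x > 0\<close> pos by (cases x r\<^sub>0 rule: linorder_cases) auto
  next
    fix R assume "R > r\<^sub>0"
    then obtain r where r: "r\<^sub>0 < r" "r < min R 1" using pos dense[of r\<^sub>0 "min R 1"] by auto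
    show "\<not> bohr_inequality_upto 2 R"
      using q_mono[of r\<^sub>0 r] r r\<^sub>0(3) pos
      by (intro not_bohr_inequality_upto_2[of r]) (auto simp: q_def)
  qed (use pos in simp)
qed

end
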